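(* Let $W$ be an $m\times n$ stochastic matrix, not all of whose rows are equal and none of whose columns is identically zero, and let $\hat p$ be a common final output with $\hat p_i>0$ for all $i$, as in the context. For every admissible pair $(r,f)$, with corresponding $g=\frac{1+f_+}{1-r_+}rW+f$, the global rates of convergence satisfy $$R(r,f)\equiv\tilde R(r,g)\ \le\ \tilde R(0,0)\equiv R(0,0),$$ where $R(0,0)$ is the global rate of the original Arimoto--Blahut algorithm.
   Context: Vectors are row vectors except that $1_m$, $1_n$ denote the column vectors of ones; $I_m$ is the identity matrix; inequalities between vectors or matrices are entrywise; $W_i$ is the $i$th row of a matrix $W$. A matrix is stochastic if it has nonnegative entries and all row sums equal to 1. $\Omega=\{p\in\mathbf{R}^{1\times m}: p\ge 0,\ p1_m=1\}$ and $\Omega(r)=\{p\in\Omega: p\ge r\}$. Logarithms are natural, $0\log 0=0$, and $H(q)=-\sum_i q_i\log q_i$ for a nonnegative vector $q$. Admissible pair: nonnegative vectors $r$ ($1\times m$) and $f$ ($1\times n$), with $r_+=r1_m$, $f_+=f1_n$, such that $r_+<1$ and $$\tilde W:=(1+f_+)\frac{I_m-1_m r}{1-r_+}W-1_m f\ \ge 0$$ (then $\tilde W$ is stochastic). The associated vector $c$ is $c_i=H(\tilde W_i)-\frac{1+f_+}{1-r_+}H(W_i)$. Algorithm III with parameters $(r,f)$: choose $p^{(0)}\in\Omega(r)$ with $p^{(0)}_i>0$ for all $i$, and iterate $p^{(t+1)}=M(p^{(t)})$, where for $p$ with positive entries $$M_i(p)=\max\Big\{r_i,\ \alpha\exp\Big(c_i+\sum_j\tilde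 W_{ij}\log\Phi_{ji}(p)\Big)\Big\},\qquad \Phi_{ji}(p)=\frac{p_i\tilde W_{ij}}{f_j+\sum_l p_l\tilde W_{lj}},$$ and $\alpha=\alpha(p)>0$ is chosen so that $\sum_i M_i(p)=1$ (terms with $\tilde W_{ij}=0$ contribute $0$). The original Arimoto--Blahut algorithm is the case $(r,f)=(0,0)$. If $p^{(t)}\to p^*$, the final output is $\hat p=(p^*-r)/(1-r_+)$; it maximizes $\sum_i p_i\sum_j W_{ij}\log(W_{ij}/(pW)_j)$ over $p\in\Omega$. Standing assumption: the algorithms under comparison all deliver the same final output $\hat p$, with $\hat p_i>0$ for all $i$; so for parameters $(r,f)$ the limit is $p^*=(1-r_+)\hat p+r$, which satisfies $p^*_i>r_i$ for all $i$ and $M(p^* )=p^*$. The matrix rate is the $m\times m$ matrix $R(p^* )$ with $(k,i)$ entry $\partial M_i/\partial p_k$ at $p^*$ ($p_1,\dots,p_m$ treated as independent variables), and the global rate of convergence $R(r,f)$ is the spectral radius of $R(p^* )$ for parameters $(r,f)$. The notation $\tilde R(r,g)$ simply means $R(r,f)$ expressed through $g=\frac{1+f_+}{1-r_+}rW+f$ (from which $f=g-(1+g_+)rW$, $g_+=g1_n$). *)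

theory Defs
  imports
    "HOL-Analysis.Derivative"
    "Jordan_Normal_Form.Spectral_Radius"
begin

unbundle no vec_syntax
unbundle no inner_syntax

(* A vec has no orientation: the row vector times matrix product v A is
   written transpose_mat A *\<^sub>v v. *)

definition entry_sum :: "real vec \<Rightarrow> real" where
  "entry_sum v = (\<Sum>i<dim_vec v. v $ i)"

definition stochastic :: "real mat \<Rightarrow> bool" where
  "stochastic A \<longleftrightarrow>
     0\<^sub>m (dim_row A) (dim_col A) \<le> A \<and> (\<forall>i<dim_row A. entry_sum (row A i) = 1)"

definition prob_simplex :: "nat \<Rightarrow> real vec \<Rightarrow> real vec set" where
  "prob_simplex m r = {p \<in> carrier_vec m. 0\<^sub>v m \<le> p \<and> entry_sum p = 1 \<and> r \<le> p}"

(* 0 log 0 = 0 holds automatically. *)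
definition entropy :: "real vec \<Rightarrow> real" where
  "entropy q = - (\<Sum>i<dim_vec q. q $ i * ln (q $ i))"

(* mat\<^sub>r m k (\<lambda>_. v) is the rank-one matrix 1_m v, all of whose m rows are v. *)
definition W_tilde :: "real mat \<Rightarrow> real vec \<Rightarrow> real vec \<Rightarrow> real mat" where
  "W_tilde W r f =
     (let m = dim_row W; n = dim_col W in
       ((1 + entry_sum f) / (1 - entry_sum r)) \<cdot>\<^sub>m ((1\<^sub>m m - mat\<^sub>r m m (\<lambda>_. r)) * W)
         - mat\<^sub>r m n (\<lambda>_. f))"

definition admissible :: "real mat \<Rightarrow> real vec \<Rightarrow> real vec \<Rightarrow> bool" where
  "admissible W r f \<longleftrightarrow>
     r \<in> carrier_vec (dim_row W) \<and> f \<in> carrier_vec (dim_col W) \<and>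
     0\<^sub>v (dim_row W) \<le> r \<and> 0\<^sub>v (dim_col W) \<le> f \<and> entry_sum r < 1 \<and>
     0\<^sub>m (dim_row W) (dim_col W) \<le> W_tilde W r f"

definition c_vec :: "real mat \<Rightarrow> real vec \<Rightarrow> real vec \<Rightarrow> real vec" where
  "c_vec W r f = vec (dim_row W) (\<lambda>i.
     entropy (row (W_tilde W r f) i) - (1 + entry_sum f) / (1 - entry_sum r) * entropy (row W i))"

definition Phi :: "real mat \<Rightarrow> real vec \<Rightarrow> real vec \<Rightarrow> real vec \<Rightarrow> nat \<Rightarrow> nat \<Rightarrow> real" where
  "Phi W r f p j i =
     p $ i * W_tilde W r f $$ (i, j) /
       (f $ j + (\<Sum>l<dim_row W. p $ l * W_tilde W r f $$ (l, j)))"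

(* Terms with W_tilde W r f $$ (i, j) = 0 vanish. *)
definition M_weight :: "real mat \<Rightarrow> real vec \<Rightarrow> real vec \<Rightarrow> real vec \<Rightarrow> nat \<Rightarrow> real" where
  "M_weight W r f p i =
     exp (c_vec W r f $ i + (\<Sum>j<dim_col W. W_tilde W r f $$ (i, j) * ln (Phi W r f p j i)))"

(* For entry_sum r < 1 the normalizer exists and is unique: the sum is continuous in a, tends to
   entry_sum r as a tends to 0, is unbounded, and is strictly increasing once it exceeds entry_sum r. *)
definition M_alpha :: "real mat \<Rightarrow> real vec \<Rightarrow> real vec \<Rightarrow> real vec \<Rightarrow> real" where
  "M_alpha W r f p =
     (THE a. a > 0 \<and> (\<Sum>i<dim_row W. max (r $ i) (a * M_weight W r f p i)) = 1)"

definition M :: "real mat \<Rightarrow> real vec \<Rightarrow> real vec \<Rightarrow> real vec \<Rightarrow> real vec" where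
  "M W r f p =
     vec (dim_row W) (\<lambda>i. max (r $ i) (M_alpha W r f p * M_weight W r f p i))"

definition final_output :: "real mat \<Rightarrow> real vec \<Rightarrow> real vec \<Rightarrow> real vec \<Rightarrow> bool" where
  "final_output W r f phat \<longleftrightarrow>
     (\<exists>p0 pstar.
        p0 \<in> prob_simplex (dim_row W) r \<and> (\<forall>i<dim_row W. p0 $ i > 0) \<and>
        pstar \<in> carrier_vec (dim_row W) \<and>
        (\<forall>i<dim_row W. (\<lambda>t. (M W r f ^^ t) p0 $ i) \<longlonglongrightarrow> pstar $ i) \<and>
        phat = (1 / (1 - entry_sum r)) \<cdot>\<^sub>v (pstar - r))"

(* Entry (k, i) is the partial derivative of M_i with respect to p_k. *)
definition matrix_rate :: "real mat \<Rightarrow> real vec \<Rightarrow> real vec \<Rightarrow> real vec \<Rightarrow> real mat" where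
  "matrix_rate W r f p =
     mat (dim_row W) (dim_row W) (\<lambda>(k, i).
       deriv (\<lambda>x. M W r f (vec (dim_row W) (\<lambda>l. if l = k then x else p $ l)) $ i) (p $ k))"

definition global_rate :: "real mat \<Rightarrow> real vec \<Rightarrow> real vec \<Rightarrow> real vec \<Rightarrow> real" where
  "global_rate W phat r f =
     spectral_radius
       (map_mat complex_of_real (matrix_rate W r f ((1 - entry_sum r) \<cdot>\<^sub>v phat + r)))"

definition global_rate_tilde :: "real mat \<Rightarrow> real vec \<Rightarrow> real vec \<Rightarrow> real vec \<Rightarrow> real" where
  "global_rate_tilde W phat r g =
     global_rate W phat r (g - (1 + entry_sum g) \<cdot>\<^sub>v (transpose_mat W *\<^sub>v r))"

end

theory Submission
  imports Defs
begin

text \<open>Near \<open>p\<^sup>*\<close> the maximum in \<open>M\<close> is inactive, so differentiating the normalized weights gives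
  \<open>R\<^sub>k\<^sub>i = \<delta>\<^sub>k\<^sub>i - p\<^sup>*\<^sub>i \<Sum>\<^sub>j V\<^sub>k\<^sub>j (V\<^sub>i\<^sub>j + f\<^sub>j) / d\<^sub>j\<close>, where \<open>V\<close> is the transformed matrix \<open>W_tilde W r f\<close> and
  \<open>d = f + p\<^sup>* V = (1 + f\<^sub>+) phat W\<close>. Modulo constants an eigenvector of \<open>R\<close> for \<open>\<mu>\<close> may be taken
  orthogonal to constants in the \<open>p\<^sup>*\<close>-weighted inner product; pairing with it shows
  \<open>(1 - \<mu>) N = G\<close> with \<open>N = \<Sum>\<^sub>i p\<^sup>*\<^sub>i \<bar>y\<^sub>i\<bar>\<^sup>2\<close> and \<open>G = \<Sum>\<^sub>j \<bar>\<Sum>\<^sub>i p\<^sup>*\<^sub>i V\<^sub>i\<^sub>j y\<^sub>i\<bar>\<^sup>2 / d\<^sub>j\<close>, and Cauchy--Schwarz gives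
  \<open>0 \<le> G \<le> N\<close>. Substituting \<open>z = p\<^sup>* y / phat\<close> turns \<open>G\<close> into a multiple of the corresponding form
  of the original algorithm, whose rate matrix is self-adjoint, so that this form is at least
  \<open>1 - R(0,0)\<close> times the squared norm of \<open>z\<close>. Since \<open>p\<^sup>* \<ge> (1 - r\<^sub>+) phat\<close> and
  \<open>(1 + f\<^sub>+) / (1 - r\<^sub>+) \<ge> 1\<close>, the factors only help, and \<open>\<mu> \<le> R(0,0)\<close>.\<close>

section \<open>Weighted inner products and spectral radii\<close>

lemma weighted_Cauchy_Schwarz:
  fixes w u v :: "'a \<Rightarrow> real"
  assumes "\<And>i. i \<in> I \<Longrightarrow> w i \<ge> 0"
  shows "(\<Sum>i\<in>I. w i * u i * v i)\<^sup>2 \<le> (\<Sum>i\<in>I. w i * (u i)\<^sup>2) * (\<Sum>i\<in>I. w i * (v i)\<^sup>2)"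
proof -
  have "(\<Sum>i\<in>I. w i * u i * v i) = (\<Sum>i\<in>I. (sqrt (w i) * u i) * (sqrt (w i) * v i))"
    using assms by (intro sum.cong) (auto simp: algebra_simps simp flip: real_sqrt_mult)
  moreover have "(\<Sum>i\<in>I. w i * (x i)\<^sup>2) = (\<Sum>i\<in>I. (sqrt (w i) * x i)\<^sup>2)" for x
    using assms by (intro sum.cong) (auto simp: power_mult_distrib)
  ultimately show ?thesis
    using Cauchy_Schwarz_ineq_sum[of "\<lambda>i. sqrt (w i) * u i" "\<lambda>i. sqrt (w i) * v i" I] by simp
qed

lemma spectral_radius_nonneg:
  assumes "A \<in> carrier_mat n n" "n > 0"
  shows "0 \<le> spectral_radius A"
  using spectral_radius_mem_max(1)[OF assms] by auto

lemma spectral_radius_leI: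
  assumes "A \<in> carrier_mat n n" "n > 0"
    and "\<And>\<mu> x. eigenvector A x \<mu> \<Longrightarrow> cmod \<mu> \<le> b"
  shows "spectral_radius A \<le> b"
  using spectral_radius_mem_max(1)[OF assms(1,2)] assms(3)
  by (auto simp: spectrum_def eigenvalue_def)

text \<open>An eigenvector of \<open>c A\<close> for \<open>\<mu>\<close> is one of \<open>A\<close>
  for \<open>\<mu> / c\<close>. This serves to scale a matrix below spectral radius 1.\<close>

lemma spectral_radius_smult_le:
  fixes A :: "complex mat"
  assumes A: "A \<in> carrier_mat n n" and n: "n > 0" and c: "c \<noteq> 0"
  shows "spectral_radius (c \<cdot>\<^sub>m A) \<le> cmod c * spectral_radius A"
proof (rule spectral_radius_leI[OF _ n])
  fix \<mu> x assume "eigenvector (c \<cdot>\<^sub>m A) x \<mu>"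
  then have x: "x \<in> carrier_vec n" "x \<noteq> 0\<^sub>v n" and eq: "(c \<cdot>\<^sub>m A) *\<^sub>v x = \<mu> \<cdot>\<^sub>v x"
    using A by (auto simp: eigenvector_def)
  have "A *\<^sub>v x = (\<mu> / c) \<cdot>\<^sub>v x"
  proof (rule eq_vecI)
    fix i assume i: "i < dim_vec ((\<mu> / c) \<cdot>\<^sub>v x)"
    then have "c * (A *\<^sub>v x) $ i = \<mu> * x $ i"
      using arg_cong[OF eq, of "\<lambda>v. v $ i"] A x
      by (simp add: smult_scalar_prod_distrib[OF row_carrier_vec])
    then show "(A *\<^sub>v x) $ i = ((\<mu> / c) \<cdot>\<^sub>v x) $ i"
      using c i by (simp add: field_simps)
  qed (use A x in auto)
  then have "eigenvalue A (\<mu> / c)"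
    using x A by (auto simp: eigenvalue_def eigenvector_def)
  then have "cmod (\<mu> / c) \<le> spectral_radius A"
    by (intro spectral_radius_mem_max(2)[OF A n]) (auto simp: spectrum_def)
  then show "cmod \<mu> \<le> cmod c * spectral_radius A"
    using c by (simp add: norm_divide field_simps)
qed (use A in auto)

text \<open>By symmetry and Cauchy--Schwarz the squared norms of \<open>A\<^sup>k v\<close> form a log-convex sequence, so
  they would grow geometrically if the first step were an increase.\<close>
lemma selfadjoint_contraction:
  fixes A :: "real mat" and w :: "nat \<Rightarrow> real"
  assumes A: "A \<in> carrier_mat n n" and v: "v \<in> carrier_vec n"
    and w: "\<And>i. i < n \<Longrightarrow> w i > 0"
    and sym: "\<And>i j. i < n \<Longrightarrow> j < n \<Longrightarrow> w i * A $$ (i, j) = w j * A $$ (j, i)"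
    and rho: "spectral_radius (map_mat complex_of_real A) < 1"
  shows "(\<Sum>i<n. w i * ((A *\<^sub>v v) $ i)\<^sup>2) \<le> (\<Sum>i<n. w i * (v $ i)\<^sup>2)"
proof (rule ccontr)
  define N where "N u = (\<Sum>i<n. w i * (u $ i)\<^sup>2)" for u :: "real vec"
  define u where "u k = A ^\<^sub>m k *\<^sub>v v" for k
  define a where "a k = N (u k)" for k
  have mulA: "(A *\<^sub>v x) $ i = (\<Sum>j<n. A $$ (i, j) * x $ j)" if "i < n" "x \<in> carrier_vec n" for i x
    using A that by (auto simp: scalar_prod_def atLeast0LessThan)
  have u_carr: "u k \<in> carrier_vec n" for k
    unfolding u_def by (rule mult_mat_vec_carrier[OF pow_carrier_mat[OF A] v])
  \<comment> \<open>Powers are built by multiplying on the right, so pulling \<open>A\<close> out on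
    the left takes an induction.\<close>
  have u_Suc: "u (Suc k) = A *\<^sub>v u k" for k
  proof -
    have "A ^\<^sub>m Suc k = A * A ^\<^sub>m k"
    proof (induction k)
      case (Suc k)
      then show ?case
        using assoc_mult_mat[OF A pow_carrier_mat[OF A] A, of k] by simp
    qed (use A in simp)
    then show ?thesis unfolding u_def
      using assoc_mult_mat_vec[OF A pow_carrier_mat[OF A] v] by simp
  qed
  have adj: "(\<Sum>i<n. w i * (A *\<^sub>v x) $ i * y $ i) = (\<Sum>i<n. w i * x $ i * (A *\<^sub>v y) $ i)"
    if x: "x \<in> carrier_vec n" and y: "y \<in> carrier_vec n" for x y
  proof -
    have "(\<Sum>i<n. w i * (A *\<^sub>v x) $ i * y $ i) = (\<Sum>i<n. \<Sum>j<n. (w i * A $$ (i, j)) * x $ j * y $ i)"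
      by (intro sum.cong refl) (simp add: mulA x sum_distrib_left sum_distrib_right algebra_simps)
    also have "\<dots> = (\<Sum>i<n. \<Sum>j<n. (w j * A $$ (j, i)) * x $ j * y $ i)"
      by (intro sum.cong refl) (simp add: sym)
    also have "\<dots> = (\<Sum>j<n. \<Sum>i<n. (w j * A $$ (j, i)) * x $ j * y $ i)"
      by (rule sum.swap)
    also have "\<dots> = (\<Sum>i<n. w i * x $ i * (A *\<^sub>v y) $ i)"
      by (intro sum.cong refl) (simp add: mulA y sum_distrib_left sum_distrib_right algebra_simps)
    finally show ?thesis .
  qed
  have a_nonneg: "a k \<ge> 0" for k
    unfolding a_def N_def using w by (intro sum_nonneg) (auto simp: less_imp_le)
  have logconvex: "(a (Suc k))\<^sup>2 \<le> a k * a (Suc (Suc k))" for k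
  proof -
    \<comment> \<open>Moving one factor \<open>A\<close> across the inner product turns the squared
      norm of \<open>u (k + 1)\<close> into the pairing of \<open>u k\<close> with
      \<open>u (k + 2)\<close>.\<close>
    have "a (Suc k) = (\<Sum>i<n. w i * u k $ i * u (Suc (Suc k)) $ i)"
      using adj[OF u_carr[of k] u_carr[of "Suc k"]]
      by (simp add: a_def N_def u_Suc power2_eq_square mult.assoc)
    then show ?thesis
      using weighted_Cauchy_Schwarz[of "{..<n}" w "\<lambda>i. u k $ i" "\<lambda>i. u (Suc (Suc k)) $ i"] w
      by (auto simp: a_def N_def less_imp_le)
  qed
  assume "\<not> ?thesis"
  then have a01: "a 0 < a 1"
    using u_Suc[of 0] v A by (simp add: a_def N_def u_def)
  have a1: "0 < a 1"
    using a01 a_nonneg[of 0] by simp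
  have a0: "0 < a 0"
  proof -
    have "a 0 \<noteq> 0" using logconvex[of 0] a1 by auto
    then show ?thesis using a_nonneg[of 0] by simp
  qed
  define q where "q = a 1 / a 0"
  have q: "q > 1" using a01 a0 by (simp add: q_def)
  \<comment> \<open>By log-convexity the ratios of consecutive terms do not decrease, so none falls
    below the first ratio \<open>q > 1\<close>.\<close>
  have step: "a (Suc k) \<ge> q * a k \<and> a k > 0" for k
  proof (induction k)
    case 0
    show ?case using a0 by (simp add: q_def)
  next
    case (Suc k)
    then have pos: "a (Suc k) > 0"
      using q less_le_trans[OF mult_pos_pos[of q "a k"], of "a (Suc k)"] by auto
    have "q * a k * a (Suc k) \<le> (a (Suc k))\<^sup>2"
      using Suc pos by (simp add: power2_eq_square)
    also have "\<dots> \<le> a k * a (Suc (Suc k))" by (rule logconvex)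
    finally have "a k * (q * a (Suc k)) \<le> a k * a (Suc (Suc k))" by (simp add: algebra_simps)
    then show ?case using Suc pos by simp
  qed
  have grow: "a k \<ge> q ^ k * a 0" for k
  proof (induction k)
    case (Suc k)
    have "q ^ Suc k * a 0 \<le> q * a k" using Suc q by (simp add: mult.assoc)
    then show ?case using step[of k] by linarith
  qed simp
  \<comment> \<open>Spectral radius below 1 keeps the entries of all powers within one constant,
    which contradicts the geometric growth.\<close>
  obtain c where c: "\<And>k. norm_bound (map_mat complex_of_real A ^\<^sub>m k) c"
    using spectral_radius_jnf_norm_bound_less_1_upper_triangular[of "map_mat complex_of_real A" n] A rho
    by auto
  define S where "S = (\<Sum>j<n. \<bar>v $ j\<bar>)"
  have u_bound: "\<bar>u k $ i\<bar> \<le> c * S" if i: "i < n" for i k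
  proof -
    have entry: "\<bar>(A ^\<^sub>m k) $$ (i, j)\<bar> \<le> c" if j: "j < n" for j
    proof -
      have "map_mat complex_of_real A ^\<^sub>m k = map_mat complex_of_real (A ^\<^sub>m k)"
        by (rule of_real_hom.mat_hom_pow[OF A, symmetric])
      then show ?thesis
        using c[of k] i j A by (auto simp: norm_bound_def)
    qed
    have "u k $ i = (\<Sum>j<n. (A ^\<^sub>m k) $$ (i, j) * v $ j)"
      unfolding u_def using A v i by (auto simp: scalar_prod_def atLeast0LessThan)
    then have "\<bar>u k $ i\<bar> \<le> (\<Sum>j<n. \<bar>(A ^\<^sub>m k) $$ (i, j)\<bar> * \<bar>v $ j\<bar>)"
      using sum_abs[of "\<lambda>j. (A ^\<^sub>m k) $$ (i, j) * v $ j" "{..<n}"] by (simp add: abs_mult)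
    also have "\<dots> \<le> (\<Sum>j<n. c * \<bar>v $ j\<bar>)"
      using entry by (intro sum_mono mult_right_mono) auto
    finally show ?thesis by (simp add: S_def sum_distrib_left)
  qed
  have "a k \<le> (\<Sum>i<n. w i * (c * S)\<^sup>2)" for k
    unfolding a_def N_def
  proof (intro sum_mono mult_left_mono)
    fix i assume "i \<in> {..<n}"
    then have "\<bar>u k $ i\<bar> \<le> \<bar>c * S\<bar>" "0 < w i"
      using u_bound[of i k] w[of i] by auto
    then show "(u k $ i)\<^sup>2 \<le> (c * S)\<^sup>2" "0 \<le> w i"
      by (simp_all add: abs_le_square_iff)
  qed
  moreover obtain k where "(\<Sum>i<n. w i * (c * S)\<^sup>2) / a 0 < q ^ k"
    using real_arch_pow[OF q] by blast
  ultimately show False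
    using grow[of k] a0 by (simp add: pos_divide_less_eq) (meson leD order_trans)
qed

text \<open>This replaces the spectral theorem: for \<open>t\<close> above the spectral radius,
  \<open>A / t\<close> is a contraction in the weighted norm, so Cauchy--Schwarz bounds the form by
  \<open>t\<close> times the squared norm; then \<open>t\<close> decreases to the spectral
  radius.\<close>

lemma selfadjoint_quadratic_form_le:
  fixes A :: "real mat" and w :: "nat \<Rightarrow> real"
  assumes A: "A \<in> carrier_mat n n" and n: "n > 0" and v: "v \<in> carrier_vec n"
    and w: "\<And>i. i < n \<Longrightarrow> w i > 0"
    and sym: "\<And>i j. i < n \<Longrightarrow> j < n \<Longrightarrow> w i * A $$ (i, j) = w j * A $$ (j, i)"
  shows "(\<Sum>i<n. w i * v $ i * (A *\<^sub>v v) $ i)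
    \<le> spectral_radius (map_mat complex_of_real A) * (\<Sum>i<n. w i * (v $ i)\<^sup>2)"
proof -
  let ?\<rho> = "spectral_radius (map_mat complex_of_real A)"
  let ?N = "\<lambda>u. \<Sum>i<n. w i * (u $ i)\<^sup>2"
  have cA: "map_mat complex_of_real A \<in> carrier_mat n n" using A by simp
  have N_nonneg: "?N u \<ge> 0" for u
    using w by (intro sum_nonneg) (auto simp: less_imp_le)
  have *: "(\<Sum>i<n. w i * v $ i * (A *\<^sub>v v) $ i) \<le> t * ?N v" if t: "t > ?\<rho>" for t
  proof -
    have t0: "t > 0" using t spectral_radius_nonneg[OF cA n] by simp
    define B where "B = (1 / t) \<cdot>\<^sub>m A"
    have "map_mat complex_of_real B = complex_of_real (1 / t) \<cdot>\<^sub>m map_mat complex_of_real A"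
      unfolding B_def by (rule eq_matI) auto
    then have "spectral_radius (map_mat complex_of_real B) \<le> (1 / t) * ?\<rho>"
      using spectral_radius_smult_le[OF cA n, of "complex_of_real (1 / t)"] t0
      by (simp add: norm_divide)
    also have "\<dots> < 1" using t t0 by simp
    finally have B: "?N (B *\<^sub>v v) \<le> ?N v"
      using A v w sym
      by (intro selfadjoint_contraction) (auto simp: B_def)
    have BA: "(A *\<^sub>v v) $ i = t * (B *\<^sub>v v) $ i" if "i < n" for i
      using A v that t0 by (simp add: B_def smult_scalar_prod_distrib[OF row_carrier_vec])
    have "(\<Sum>i<n. w i * v $ i * (B *\<^sub>v v) $ i)\<^sup>2 \<le> ?N v * ?N (B *\<^sub>v v)"
      using w by (intro weighted_Cauchy_Schwarz) (auto simp: less_imp_le)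
    also have "\<dots> \<le> (?N v)\<^sup>2"
      using B N_nonneg[of v] by (simp add: power2_eq_square mult_left_mono)
    finally have "(\<Sum>i<n. w i * v $ i * (B *\<^sub>v v) $ i) \<le> ?N v"
      by (rule power2_le_imp_le) (rule N_nonneg)
    then have "t * (\<Sum>i<n. w i * v $ i * (B *\<^sub>v v) $ i) \<le> t * ?N v"
      using t0 by simp
    then show ?thesis
      by (simp add: BA sum_distrib_left mult.left_commute mult.assoc)
  qed
  show ?thesis
  proof (cases "?N v = 0")
    case True
    then show ?thesis using *[of "?\<rho> + 1"] by simp
  next
    case False
    then have pos: "?N v > 0" using N_nonneg[of v] by simp
    have "(\<Sum>i<n. w i * v $ i * (A *\<^sub>v v) $ i) / ?N v \<le> ?\<rho>"
      by (rule dense_ge) (use * pos in \<open>simp add: pos_divide_le_eq\<close>)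
    then show ?thesis using pos by (simp add: pos_divide_le_eq)
  qed
qed

section \<open>The transformed matrix and the common setting\<close>

lemma W_tilde_index:
  assumes W: "W \<in> carrier_mat m n" and r: "r \<in> carrier_vec m" and f: "f \<in> carrier_vec n"
    and i: "i < m" and j: "j < n"
  shows "W_tilde W r f $$ (i, j) =
    (1 + entry_sum f) / (1 - entry_sum r) * (W $$ (i, j) - (\<Sum>l<m. r $ l * W $$ (l, j))) - f $ j"
proof -
  have "((1\<^sub>m m - mat\<^sub>r m m (\<lambda>_. r)) * W) $$ (i, j)
      = (\<Sum>l<m. ((if i = l then 1 else 0) - r $ l) * W $$ (l, j))"
    using W i j by (auto simp: scalar_prod_def atLeast0LessThan intro!: sum.cong)
  also have "\<dots> = (\<Sum>l<m. (if i = l then W $$ (l, j) else 0) - r $ l * W $$ (l, j))"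
    by (intro sum.cong) (auto simp: algebra_simps)
  also have "\<dots> = W $$ (i, j) - (\<Sum>l<m. r $ l * W $$ (l, j))"
    using i by (simp add: sum_subtractf)
  finally show ?thesis
    using assms by (simp add: W_tilde_def Let_def del: index_mult_mat(1))
qed

text \<open>Interpreted twice in the end, with the same \<open>phat\<close>: once for the given
  parameters and once for the original algorithm.\<close>

locale arimoto_blahut =
  fixes m n :: nat and W :: "real mat" and phat r f :: "real vec"
  assumes W_carrier: "W \<in> carrier_mat m n"
    and W_stochastic: "stochastic W"
    and m_pos: "m > 0"
    and W_col: "\<And>j. j < n \<Longrightarrow> col W j \<noteq> 0\<^sub>v m"
    and phat_pos: "\<And>i. i < m \<Longrightarrow> phat $ i > 0"
    and adm: "admissible W r f"
    and final: "final_output W r f phat"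
begin

abbreviation V :: "nat \<Rightarrow> nat \<Rightarrow> real" where
  "V i j \<equiv> W_tilde W r f $$ (i, j)"

abbreviation wt :: "real vec \<Rightarrow> nat \<Rightarrow> real" where
  "wt p i \<equiv> M_weight W r f p i"

abbreviation den :: "real vec \<Rightarrow> nat \<Rightarrow> real" where
  "den p j \<equiv> f $ j + (\<Sum>l<m. p $ l * V l j)"

definition pstar :: "real vec" where
  "pstar = (1 - entry_sum r) \<cdot>\<^sub>v phat + r"

definition qhat :: "nat \<Rightarrow> real" where
  "qhat j = (\<Sum>i<m. phat $ i * W $$ (i, j))"

definition s :: real where
  "s = (1 + entry_sum f) / (1 - entry_sum r)"

lemma dims: "dim_row W = m" "dim_col W = n" "dim_vec r = m" "dim_vec f = n"
  "r \<in> carrier_vec m" "f \<in> carrier_vec n"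
  using W_carrier adm by (auto simp: admissible_def)

lemma r_nonneg: "i < m \<Longrightarrow> r $ i \<ge> 0"
  and f_nonneg: "j < n \<Longrightarrow> f $ j \<ge> 0"
  and r_less_1: "entry_sum r < 1"
  and V_nonneg: "i < m \<Longrightarrow> j < n \<Longrightarrow> V i j \<ge> 0"
  using adm dims by (auto simp: admissible_def less_eq_vec_def less_eq_mat_def)

lemma entry_sum_r: "entry_sum r = (\<Sum>i<m. r $ i)"
  and entry_sum_f: "entry_sum f = (\<Sum>j<n. f $ j)"
  by (simp_all add: entry_sum_def dims)

lemma r_plus_nonneg: "entry_sum r \<ge> 0" and f_plus_nonneg: "entry_sum f \<ge> 0"
  unfolding entry_sum_r entry_sum_f by (auto intro!: sum_nonneg r_nonneg f_nonneg)

lemma s_ge_1: "s \<ge> 1"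
  using r_plus_nonneg f_plus_nonneg r_less_1 by (simp add: s_def)

lemma W_nonneg: "i < m \<Longrightarrow> j < n \<Longrightarrow> W $$ (i, j) \<ge> 0"
  and W_row_sum: "i < m \<Longrightarrow> (\<Sum>j<n. W $$ (i, j)) = 1"
  using W_stochastic dims by (auto simp: stochastic_def less_eq_mat_def entry_sum_def)

lemma V_eq:
  assumes "i < m" "j < n"
  shows "V i j = s * (W $$ (i, j) - (\<Sum>l<m. r $ l * W $$ (l, j))) - f $ j"
  unfolding s_def by (rule W_tilde_index[OF W_carrier dims(5,6) assms])

lemma r_W_sum: "(\<Sum>j<n. \<Sum>l<m. r $ l * W $$ (l, j)) = entry_sum r"
proof -
  have "(\<Sum>j<n. \<Sum>l<m. r $ l * W $$ (l, j)) = (\<Sum>l<m. r $ l * (\<Sum>j<n. W $$ (l, j)))"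
    by (subst sum.swap) (simp add: sum_distrib_left)
  then show ?thesis by (simp add: W_row_sum entry_sum_r)
qed

lemma V_row_sum:
  assumes "i < m"
  shows "(\<Sum>j<n. V i j) = 1"
proof -
  have "(\<Sum>j<n. V i j) = s * ((\<Sum>j<n. W $$ (i, j)) - (\<Sum>j<n. \<Sum>l<m. r $ l * W $$ (l, j))) - entry_sum f"
    by (simp add: V_eq assms sum_subtractf sum_distrib_left entry_sum_f right_diff_distrib)
  also have "\<dots> = s * (1 - entry_sum r) - entry_sum f"
    by (simp add: W_row_sum assms r_W_sum)
  also have "\<dots> = 1" using r_less_1 by (simp add: s_def)
  finally show ?thesis .
qed

section \<open>The normalizer and the map \<open>M\<close>\<close>

lemma wt_pos: "wt p i > 0"
  by (simp add: M_weight_def)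

lemma wt_sum_pos: "(\<Sum>i<m. wt p i) > 0"
  using m_pos by (intro sum_pos) (auto simp: wt_pos)

lemma ex1_normalizer: "\<exists>!a. a > 0 \<and> (\<Sum>i<m. max (r $ i) (a * wt p i)) = 1"
proof -
  define F where "F a = (\<Sum>i<m. max (r $ i) (a * wt p i))" for a
  have F_less: "F a < F b" if "a < b" "F a = 1" for a b
  proof -
    \<comment> \<open>If every maximum were attained by \<open>r\<close>, the total would be
      \<open>entry_sum r < 1\<close>. One active term makes \<open>F\<close> strictly increasing
      from \<open>a\<close> on.\<close>
    have "\<exists>i<m. r $ i < a * wt p i"
    proof (rule ccontr)
      assume "\<not> ?thesis"
      then have "F a = (\<Sum>i<m. r $ i)"
        unfolding F_def by (intro sum.cong refl) (metis lessThan_iff max_absorb1 not_less)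
      then show False using that r_less_1 entry_sum_r by simp
    qed
    then obtain i where i: "i < m" "r $ i < a * wt p i" by blast
    have le: "a * wt p k < b * wt p k" for k
      using that wt_pos by simp
    show ?thesis unfolding F_def
    proof (rule sum_strict_mono_ex1)
      show "\<forall>k\<in>{..<m}. max (r $ k) (a * wt p k) \<le> max (r $ k) (b * wt p k)"
        by (intro ballI max.mono order_refl less_imp_le[OF le])
      show "\<exists>k\<in>{..<m}. max (r $ k) (a * wt p k) < max (r $ k) (b * wt p k)"
        using i le[of i] by (intro bexI[of _ i]) auto
    qed simp
  qed
  have F0: "F 0 = entry_sum r"
    unfolding F_def entry_sum_r by (intro sum.cong) (auto simp: r_nonneg)
  \<comment> \<open>With this \<open>b\<close> the term of index 0 alone reaches 1, which gives the
    upper end for the intermediate value theorem.\<close>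
  define b where "b = 1 / wt p 0"
  have "b > 0" using wt_pos by (simp add: b_def)
  have "1 \<le> F b"
  proof -
    have "1 \<le> max (r $ 0) (b * wt p 0)" using wt_pos[of p 0] by (simp add: b_def)
    also have "\<dots> \<le> F b" unfolding F_def
      using m_pos r_nonneg by (intro member_le_sum) (auto simp: le_max_iff_disj)
    finally show ?thesis .
  qed
  moreover have "continuous_on {0..b} F"
    unfolding F_def by (intro continuous_intros)
  ultimately obtain a where a: "0 \<le> a" "F a = 1"
    using IVT'[of F 0 1 b] F0 r_less_1 \<open>b > 0\<close> by auto
  then have "a > 0" using F0 r_less_1 by (cases "a = 0") auto
  then have "a > 0 \<and> F a = 1" using a by simp
  moreover have "a' = a" if "a' > 0 \<and> F a' = 1" for a'
    using F_less[of a a'] F_less[of a' a] that a by (metis linorder_neqE_linordered_idom less_irrefl)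
  ultimately show ?thesis unfolding F_def by blast
qed

lemma M_index: "i < m \<Longrightarrow> M W r f p $ i = max (r $ i) (M_alpha W r f p * wt p i)"
  by (simp add: M_def dims)

lemma M_sum: "(\<Sum>i<m. M W r f p $ i) = 1"
  using theI'[OF ex1_normalizer[of p]] by (simp add: M_index M_alpha_def dims)

text \<open>When the normalized weights already exceed \<open>r\<close>, the reciprocal of the total
  weight solves the normalizing equation, so by uniqueness it is the normalizer.\<close>

lemma M_eq_normalized:
  assumes "\<And>i. i < m \<Longrightarrow> r $ i < wt p i / (\<Sum>l<m. wt p l)" and i: "i < m"
  shows "M W r f p $ i = wt p i / (\<Sum>l<m. wt p l)"
proof -
  let ?S = "\<Sum>l<m. wt p l"
  have *: "max (r $ k) (1 / ?S * wt p k) = wt p k / ?S" if "k < m" for k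
    using assms(1)[OF that] by simp
  have "(\<Sum>k<m. max (r $ k) (1 / ?S * wt p k)) = (\<Sum>k<m. wt p k / ?S)"
    by (intro sum.cong refl) (simp add: * del: times_divide_eq_left)
  also have "\<dots> = 1" using wt_sum_pos[of p] by (simp flip: sum_divide_distrib)
  finally have "M_alpha W r f p = 1 / ?S"
    unfolding M_alpha_def dims using wt_sum_pos[of p]
    by (intro the1_equality[OF ex1_normalizer]) simp
  then show ?thesis using *[OF i] i by (simp add: M_index)
qed

section \<open>Continuity and the fixed point\<close>

lemma den_pos:
  assumes p: "\<And>l. l < m \<Longrightarrow> p $ l > 0" and "i < m" "j < n" "V i j \<noteq> 0"
  shows "den p j > 0"
proof -
  have "V i j > 0" using V_nonneg[of i j] assms by simp
  then have "(\<Sum>l<m. p $ l * V l j) > 0"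
    using assms by (intro sum_pos2[of _ i]) (auto intro!: mult_nonneg_nonneg V_nonneg p[THEN less_imp_le])
  then show ?thesis using f_nonneg[of j] assms by simp
qed

text \<open>The filter is arbitrary because the limit is taken both along the iterates and along a
  coordinate line through \<open>pstar\<close>. Where \<open>V i j = 0\<close> the summand is
  constantly 0, so the logarithm needs continuity only at positive arguments.\<close>

lemma tendsto_wt:
  assumes lim: "\<And>l. l < m \<Longrightarrow> ((\<lambda>t. P t $ l) \<longlongrightarrow> p $ l) F"
    and p: "\<And>l. l < m \<Longrightarrow> p $ l > 0" and i: "i < m"
  shows "((\<lambda>t. wt (P t) i) \<longlongrightarrow> wt p i) F"
proof -
  have "((\<lambda>t. V i j * ln (Phi W r f (P t) j i)) \<longlongrightarrow> V i j * ln (Phi W r f p j i)) F" if j: "j < n" for j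
  proof (cases "V i j = 0")
    case False
    have "den p j > 0" using den_pos[OF p i j False] .
    moreover have "p $ i * V i j > 0" using False V_nonneg[OF i j] p[OF i] by simp
    ultimately show ?thesis
      unfolding Phi_def dims using i
      by (intro tendsto_intros lim) auto
  qed simp
  then show ?thesis
    unfolding M_weight_def dims
    by (intro tendsto_exp tendsto_add tendsto_const tendsto_sum) simp
qed

lemma tendsto_normalized:
  assumes "\<And>l. l < m \<Longrightarrow> ((\<lambda>t. P t $ l) \<longlongrightarrow> p $ l) F"
    and "\<And>l. l < m \<Longrightarrow> p $ l > 0" and "i < m"
  shows "((\<lambda>t. wt (P t) i / (\<Sum>l<m. wt (P t) l)) \<longlongrightarrow> wt p i / (\<Sum>l<m. wt p l)) F"
  using wt_sum_pos[of p] by (intro tendsto_divide tendsto_sum tendsto_wt[OF assms(1,2)] assms) auto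

lemma pstar_carrier: "pstar \<in> carrier_vec m" and phat_carrier: "phat \<in> carrier_vec m"
  using final dims by (auto simp: pstar_def final_output_def)

lemma pstar_index: "i < m \<Longrightarrow> pstar $ i = (1 - entry_sum r) * phat $ i + r $ i"
  using dims phat_carrier by (auto simp: pstar_def)

lemma pstar_gt_r: "i < m \<Longrightarrow> pstar $ i > r $ i"
  using r_less_1 phat_pos by (simp add: pstar_index)

lemma pstar_pos: "i < m \<Longrightarrow> pstar $ i > 0"
  using pstar_gt_r[of i] r_nonneg[of i] by simp

text \<open>\<open>final_output\<close> provides only convergence. The fixed-point equation follows
  by comparing the limit of the shifted iterates with the limit given by continuity of the
  normalized weights.\<close>

lemma pstar_fixed_point:
  shows pstar_sum: "(\<Sum>i<m. pstar $ i) = 1"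
    and pstar_normalized: "\<And>i. i < m \<Longrightarrow> wt pstar i / (\<Sum>l<m. wt pstar l) = pstar $ i"
proof -
  obtain p0 p where p: "p \<in> carrier_vec m"
    and lim: "\<forall>i<m. (\<lambda>t. (M W r f ^^ t) p0 $ i) \<longlonglongrightarrow> p $ i"
    and phat: "phat = (1 / (1 - entry_sum r)) \<cdot>\<^sub>v (p - r)"
    using final dims by (auto simp: final_output_def)
  have p_eq: "p $ i = pstar $ i" if "i < m" for i
    using pstar_index[OF that] that p dims r_less_1 by (simp add: phat[THEN arg_cong, of "\<lambda>v. v $ i"])
  define P where "P t = (M W r f ^^ t) p0" for t
  have lim: "(\<lambda>t. P t $ i) \<longlonglongrightarrow> pstar $ i" if "i < m" for i
    using lim that p_eq by (simp add: P_def)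
  have lim_M: "(\<lambda>t. M W r f (P t) $ i) \<longlonglongrightarrow> pstar $ i" if "i < m" for i
    using LIMSEQ_Suc[OF lim[OF that]] by (simp add: P_def)
  have "(\<lambda>t. \<Sum>i<m. M W r f (P t) $ i) \<longlonglongrightarrow> (\<Sum>i<m. pstar $ i)"
    by (intro tendsto_sum lim_M) simp
  then show "(\<Sum>i<m. pstar $ i) = 1"
    by (simp add: M_sum LIMSEQ_const_iff)
  fix i assume i: "i < m"
  \<comment> \<open>The limit lies strictly above \<open>r\<close>, so from some iterate on no
    coordinate is cut off at \<open>r\<close>; unit total mass then determines the
    normalizer.\<close>
  have "\<forall>\<^sub>F t in sequentially. \<forall>k\<in>{..<m}. r $ k < M W r f (P t) $ k"
    using pstar_gt_r by (intro eventually_ball_finite) (auto intro: order_tendstoD(1)[OF lim_M])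
  then have "\<forall>\<^sub>F t in sequentially. M W r f (P t) $ i = wt (P t) i / (\<Sum>l<m. wt (P t) l)"
  proof eventually_elim
    case (elim t)
    define \<alpha> where "\<alpha> = M_alpha W r f (P t)"
    have *: "M W r f (P t) $ k = \<alpha> * wt (P t) k" if "k < m" for k
    proof -
      have "r $ k < M W r f (P t) $ k" using elim that by auto
      then show ?thesis
        unfolding M_index[OF that] \<alpha>_def by (auto simp: max_def split: if_splits)
    qed
    have "\<alpha> * (\<Sum>l<m. wt (P t) l) = 1"
      using M_sum[of "P t"] by (simp add: * sum_distrib_left)
    then have "\<alpha> = 1 / (\<Sum>l<m. wt (P t) l)"
      using wt_sum_pos[of "P t"] by (simp add: field_simps)
    then show ?case by (simp add: * i)
  qed
  then have "(\<lambda>t. wt (P t) i / (\<Sum>l<m. wt (P t) l)) \<longlonglongrightarrow> pstar $ i"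
    using lim_M[OF i] by (rule Lim_transform_eventually[rotated])
  moreover have "(\<lambda>t. wt (P t) i / (\<Sum>l<m. wt (P t) l)) \<longlonglongrightarrow> wt pstar i / (\<Sum>l<m. wt pstar l)"
    by (intro tendsto_normalized lim pstar_pos i)
  ultimately show "wt pstar i / (\<Sum>l<m. wt pstar l) = pstar $ i"
    using LIMSEQ_unique by blast
qed

lemma qhat_pos:
  assumes j: "j < n"
  shows "qhat j > 0"
proof -
  have "\<exists>i<m. W $$ (i, j) \<noteq> 0"
  proof (rule ccontr)
    assume "\<not> ?thesis"
    then have "col W j = 0\<^sub>v m" using dims j by (intro eq_vecI) auto
    then show False using W_col[OF j] by simp
  qed
  then obtain i where i: "i < m" "W $$ (i, j) > 0"
    using W_nonneg j by (metis less_eq_real_def)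
  then show ?thesis unfolding qhat_def
    by (intro sum_pos2[of _ i])
      (auto intro!: mult_nonneg_nonneg mult_pos_pos W_nonneg phat_pos j less_imp_le[OF phat_pos])
qed

text \<open>Since \<open>pstar\<close> has mass 1, averaging \<open>V\<close> subtracts exactly
  \<open>s r W + f\<close>. The first part cancels what \<open>r\<close> contributes through
  \<open>pstar\<close>, the second the \<open>f\<close> in \<open>den\<close>.\<close>

lemma den_pstar:
  assumes j: "j < n"
  shows "den pstar j = (1 + entry_sum f) * qhat j"
proof -
  let ?R = "\<Sum>l<m. r $ l * W $$ (l, j)"
  have "(\<Sum>l<m. pstar $ l * V l j)
      = (\<Sum>l<m. s * (pstar $ l * W $$ (l, j)) - pstar $ l * (s * ?R + f $ j))"
    using j by (intro sum.cong refl) (simp add: V_eq algebra_simps)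
  also have "\<dots> = s * (\<Sum>l<m. pstar $ l * W $$ (l, j)) - (\<Sum>l<m. pstar $ l) * (s * ?R + f $ j)"
    by (simp add: sum_subtractf sum_distrib_left sum_distrib_right)
  also have "(\<Sum>l<m. pstar $ l * W $$ (l, j)) = (1 - entry_sum r) * qhat j + ?R"
    by (simp add: pstar_index qhat_def sum.distrib sum_distrib_left distrib_right mult.assoc)
  finally have "den pstar j = s * (1 - entry_sum r) * qhat j"
    by (simp add: pstar_sum algebra_simps)
  then show ?thesis using r_less_1 by (simp add: s_def)
qed

lemma den_pstar_pos: "j < n \<Longrightarrow> den pstar j > 0"
  using qhat_pos f_plus_nonneg by (simp add: den_pstar)

section \<open>The rate matrix in closed form\<close>

definition line :: "nat \<Rightarrow> real \<Rightarrow> real vec" where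
  "line k x = vec m (\<lambda>l. if l = k then x else pstar $ l)"

lemma line_index: "l < m \<Longrightarrow> line k x $ l = (if l = k then x else pstar $ l)"
  by (simp add: line_def)

lemma line_pstar: "line k (pstar $ k) = pstar"
  unfolding line_def using pstar_carrier by (intro eq_vecI) auto

text \<open>The partial derivative in coordinate \<open>k\<close> of the logarithm of weight
  \<open>i\<close>, taken at \<open>pstar\<close>; the first term has coefficient 1 because the rows
  of \<open>V\<close> sum to 1.\<close>

definition dlog :: "nat \<Rightarrow> nat \<Rightarrow> real" where
  "dlog k i = (if i = k then 1 / pstar $ k else 0) - (\<Sum>j<n. V i j * V k j / den pstar j)"

lemma DERIV_wt:
  assumes i: "i < m" and k: "k < m"
  shows "((\<lambda>x. wt (line k x) i) has_real_derivative wt pstar i * dlog k i) (at (pstar $ k))"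
proof -
  let ?\<delta> = "if i = k then 1 else 0 :: real"
  have summand: "((\<lambda>x. V i j * ln (Phi W r f (line k x) j i)) has_real_derivative
      V i j * (?\<delta> / pstar $ k - V k j / den pstar j)) (at (pstar $ k))" if j: "j < n" for j
  \<comment> \<open>For a zero entry the summand vanishes identically; otherwise \<open>Phi\<close>
    is positive at \<open>pstar\<close> and the logarithm is differentiable there.\<close>
  proof (cases "V i j = 0")
    case False
    then have Vpos: "V i j > 0" using V_nonneg[OF i j] by simp
    have dpos: "den pstar j > 0" by (rule den_pstar_pos[OF j])
    have num: "((\<lambda>x. line k x $ i * V i j) has_real_derivative ?\<delta> * V i j) (at (pstar $ k))"
      using i by (auto simp: line_index intro!: derivative_eq_intros)
    have den_line: "den (line k x) j = den pstar j + (x - pstar $ k) * V k j" for x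
    proof -
      have "(\<Sum>l<m. line k x $ l * V l j)
          = (\<Sum>l<m. pstar $ l * V l j + (if l = k then (x - pstar $ k) * V k j else 0))"
        by (intro sum.cong refl) (auto simp: line_index algebra_simps)
      then show ?thesis using k by (simp add: sum.distrib)
    qed
    have den: "((\<lambda>x. den (line k x) j) has_real_derivative V k j) (at (pstar $ k))"
      unfolding den_line by (auto intro!: derivative_eq_intros)
    have "((\<lambda>x. Phi W r f (line k x) j i) has_real_derivative
        (?\<delta> * V i j * den pstar j - pstar $ i * V i j * V k j) / (den pstar j * den pstar j))
        (at (pstar $ k))"
      using DERIV_divide[OF num den] dpos unfolding Phi_def dims by (simp add: line_pstar)
    moreover have "Phi W r f (line k (pstar $ k)) j i > 0"
      unfolding line_pstar Phi_def dims using dpos Vpos pstar_pos[OF i] by simp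
    ultimately have "((\<lambda>x. V i j * ln (Phi W r f (line k x) j i)) has_real_derivative
        V i j * (1 / Phi W r f pstar j i *
          ((?\<delta> * V i j * den pstar j - pstar $ i * V i j * V k j) / (den pstar j * den pstar j))))
        (at (pstar $ k))"
      by (auto intro!: derivative_eq_intros simp: line_pstar)
    moreover have "1 / Phi W r f pstar j i *
          ((?\<delta> * V i j * den pstar j - pstar $ i * V i j * V k j) / (den pstar j * den pstar j))
        = ?\<delta> / pstar $ k - V k j / den pstar j"
    proof -
      have "1 / (a * v / d) * ((e * v * d - a * v * u) / (d * d)) = e / a - u / d"
        if "a > 0" "v > 0" "d > 0" for a v d e u :: real
        using that by (simp add: field_simps)
      from this[OF pstar_pos[OF i] Vpos dpos] show ?thesis
        unfolding Phi_def dims by auto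
    qed
    ultimately show ?thesis by (simp only:)
  qed simp
  have "((\<lambda>x. wt (line k x) i) has_real_derivative
      wt pstar i * (\<Sum>j<n. V i j * (?\<delta> / pstar $ k - V k j / den pstar j))) (at (pstar $ k))"
    unfolding M_weight_def dims
    by (rule derivative_eq_intros summand refl | simp add: line_pstar)+
  moreover have "(\<Sum>j<n. V i j * (?\<delta> / pstar $ k - V k j / den pstar j)) = dlog k i"
  proof -
    have "(\<Sum>j<n. V i j * (?\<delta> / pstar $ k - V k j / den pstar j))
        = (\<Sum>j<n. V i j) * (?\<delta> / pstar $ k) - (\<Sum>j<n. V i j * (V k j / den pstar j))"
      by (simp only: right_diff_distrib sum_subtractf sum_distrib_right)
    then show ?thesis by (simp add: V_row_sum[OF i] dlog_def)
  qed
  ultimately show ?thesis by simp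
qed

text \<open>This is the correction that the quotient rule produces from the total weight. It comes
  from \<open>pstar V = den - f\<close> and the unit row sums.\<close>

lemma pstar_dlog_sum:
  assumes k: "k < m"
  shows "(\<Sum>l<m. pstar $ l * dlog k l) = (\<Sum>j<n. V k j * f $ j / den pstar j)"
proof -
  have "(\<Sum>l<m. pstar $ l * dlog k l)
      = (\<Sum>l<m. (if l = k then 1 else 0) - (\<Sum>j<n. V k j / den pstar j * (pstar $ l * V l j)))"
    using pstar_pos[OF k]
    by (intro sum.cong refl) (auto simp: dlog_def right_diff_distrib sum_distrib_left mult_ac)
  also have "\<dots> = 1 - (\<Sum>l<m. \<Sum>j<n. V k j / den pstar j * (pstar $ l * V l j))"
    using k by (simp add: sum_subtractf)
  also have "\<dots> = (\<Sum>j<n. V k j) - (\<Sum>j<n. V k j / den pstar j * (\<Sum>l<m. pstar $ l * V l j))"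
    by (subst sum.swap) (simp add: sum_distrib_left V_row_sum k)
  also have "\<dots> = (\<Sum>j<n. V k j - V k j / den pstar j * (den pstar j - f $ j))"
    by (simp add: sum_subtractf)
  also have "\<dots> = (\<Sum>j<n. V k j * f $ j / den pstar j)"
  proof (intro sum.cong refl)
    fix j assume "j \<in> {..<n}"
    then have "den pstar j \<noteq> 0" using den_pstar_pos[of j] by simp
    have "v - v / d * (d - g) = v * g / d" if "d \<noteq> 0" for v d g :: real
      using that by (simp add: field_simps)
    from this[OF \<open>den pstar j \<noteq> 0\<close>]
    show "V k j - V k j / den pstar j * (den pstar j - f $ j) = V k j * f $ j / den pstar j" .
  qed
  finally show ?thesis .
qed

definition R :: "real mat" where
  "R = matrix_rate W r f pstar"

lemma R_carrier: "R \<in> carrier_mat m m"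
  by (simp add: R_def matrix_rate_def dims)

lemma R_index:
  assumes i: "i < m" and k: "k < m"
  shows "R $$ (k, i) = (if i = k then 1 else 0)
    - pstar $ i * (\<Sum>j<n. V k j * (V i j + f $ j) / den pstar j)"
proof -
  let ?S = "\<lambda>p. \<Sum>l<m. wt p l"
  have S: "?S pstar > 0" by (rule wt_sum_pos)
  have DS: "((\<lambda>x. ?S (line k x)) has_real_derivative (\<Sum>l<m. wt pstar l * dlog k l)) (at (pstar $ k))"
    by (intro DERIV_sum DERIV_wt k) auto
  have D: "((\<lambda>x. wt (line k x) i / ?S (line k x)) has_real_derivative
      (wt pstar i * dlog k i * ?S pstar - wt pstar i * (\<Sum>l<m. wt pstar l * dlog k l))
        / (?S pstar * ?S pstar)) (at (pstar $ k))"
    using DERIV_divide[OF DERIV_wt[OF i k] DS] S by (simp add: line_pstar)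
  \<comment> \<open>The limit is along \<open>nhds\<close>, including the point itself, because
    derivatives may be exchanged only for functions that agree on a full neighbourhood.\<close>
  have line_lim: "((\<lambda>x. line k x $ l) \<longlongrightarrow> pstar $ l) (nhds (pstar $ k))" if "l < m" for l
    using that by (cases "l = k") (simp_all add: line_index filterlim_ident)
  have "\<forall>\<^sub>F x in nhds (pstar $ k). \<forall>l\<in>{..<m}. r $ l < wt (line k x) l / ?S (line k x)"
  proof (intro eventually_ball_finite ballI)
    fix l assume "l \<in> {..<m}"
    then show "\<forall>\<^sub>F x in nhds (pstar $ k). r $ l < wt (line k x) l / ?S (line k x)"
      using pstar_gt_r[of l] pstar_normalized[of l]
      by (intro order_tendstoD(1)[OF tendsto_normalized[OF line_lim pstar_pos]]) auto
  qed simp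
  then have ev: "\<forall>\<^sub>F x in nhds (pstar $ k). M W r f (line k x) $ i = wt (line k x) i / ?S (line k x)"
    by eventually_elim (auto intro!: M_eq_normalized i)
  have "((\<lambda>x. M W r f (line k x) $ i) has_real_derivative
      (wt pstar i * dlog k i * ?S pstar - wt pstar i * (\<Sum>l<m. wt pstar l * dlog k l))
        / (?S pstar * ?S pstar)) (at (pstar $ k))"
    using DERIV_cong_ev[OF refl ev refl] D by simp
  then have "R $$ (k, i) = (wt pstar i * dlog k i * ?S pstar - wt pstar i * (\<Sum>l<m. wt pstar l * dlog k l))
        / (?S pstar * ?S pstar)"
    using i k by (simp add: R_def matrix_rate_def dims line_def DERIV_imp_deriv)
  \<comment> \<open>Dividing by the total weight turns each weight into the corresponding coordinate
    of the fixed point.\<close>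
  also have "\<dots> = (wt pstar i / ?S pstar) * (dlog k i - (\<Sum>l<m. (wt pstar l / ?S pstar) * dlog k l))"
    using S by (simp add: sum_divide_distrib[symmetric] field_simps)
  also have "\<dots> = pstar $ i * (dlog k i - (\<Sum>l<m. pstar $ l * dlog k l))"
    by (simp add: pstar_normalized i)
  also have "\<dots> = pstar $ i * (if i = k then 1 / pstar $ k else 0)
      - pstar $ i * ((\<Sum>j<n. V i j * V k j / den pstar j) + (\<Sum>j<n. V k j * f $ j / den pstar j))"
    unfolding pstar_dlog_sum[OF k] by (simp add: dlog_def algebra_simps)
  also have "pstar $ i * (if i = k then 1 / pstar $ k else 0) = (if i = k then 1 else 0)"
    using pstar_pos[OF i] by auto
  also have "(\<Sum>j<n. V i j * V k j / den pstar j) + (\<Sum>j<n. V k j * f $ j / den pstar j)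
      = (\<Sum>j<n. V k j * (V i j + f $ j) / den pstar j)"
    unfolding sum.distrib[symmetric]
    by (intro sum.cong refl) (simp add: add_divide_distrib[symmetric] algebra_simps)
  finally show ?thesis .
qed


section \<open>Bounds for the quadratic form and the eigenvalues\<close>

text \<open>With \<open>b\<^sub>j = \<Sum>\<^sub>i p\<^sup>*\<^sub>i V\<^sub>i\<^sub>j y\<^sub>i\<close>, the form \<open>\<Sum>\<^sub>j b\<^sub>j\<^sup>2 / den\<^sub>j\<close> bounded in the next two lemmas is
  \<open>\<langle>y, (1 - R) y\<rangle>\<close> in the \<open>p\<^sup>*\<close>-weighted inner product whenever \<open>y\<close> is orthogonal to constants.\<close>
lemma form_le:
  fixes y :: "nat \<Rightarrow> real"
  shows "(\<Sum>j<n. (\<Sum>i<m. pstar $ i * V i j * y i)\<^sup>2 / den pstar j) \<le> (\<Sum>i<m. pstar $ i * (y i)\<^sup>2)"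
proof -
  have "(\<Sum>i<m. pstar $ i * V i j * y i)\<^sup>2 / den pstar j \<le> (\<Sum>i<m. pstar $ i * V i j * (y i)\<^sup>2)"
    if j: "j < n" for j
  proof -
    have nonneg: "0 \<le> pstar $ i * V i j" if "i < m" for i
      using that j by (intro mult_nonneg_nonneg less_imp_le[OF pstar_pos] V_nonneg)
    have "(\<Sum>i<m. pstar $ i * V i j * y i)\<^sup>2
        \<le> (\<Sum>i<m. pstar $ i * V i j * (y i)\<^sup>2) * (\<Sum>i<m. pstar $ i * V i j)"
      using weighted_Cauchy_Schwarz[of "{..<m}" "\<lambda>i. pstar $ i * V i j" y "\<lambda>_. 1"] nonneg by simp
    \<comment> \<open>The last factor equals \<open>den pstar j - f $ j\<close>.\<close>
    also have "\<dots> \<le> (\<Sum>i<m. pstar $ i * V i j * (y i)\<^sup>2) * den pstar j"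
      using f_nonneg[OF j] nonneg by (intro mult_left_mono sum_nonneg) auto
    finally show ?thesis using den_pstar_pos[OF j] by (simp add: pos_divide_le_eq)
  qed
  then have "(\<Sum>j<n. (\<Sum>i<m. pstar $ i * V i j * y i)\<^sup>2 / den pstar j)
      \<le> (\<Sum>j<n. \<Sum>i<m. pstar $ i * V i j * (y i)\<^sup>2)"
    by (intro sum_mono) auto
  also have "\<dots> = (\<Sum>i<m. pstar $ i * (y i)\<^sup>2 * (\<Sum>j<n. V i j))"
    by (subst sum.swap) (simp add: sum_distrib_left mult_ac)
  finally show ?thesis by (simp add: V_row_sum)
qed

lemma form_ge:
  fixes y :: "nat \<Rightarrow> real"
  assumes base: "\<And>z. (1 - \<rho>) * (\<Sum>i<m. phat $ i * (z i)\<^sup>2)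
      \<le> (\<Sum>j<n. (\<Sum>i<m. phat $ i * W $$ (i, j) * z i)\<^sup>2 / qhat j)"
    and rho: "\<rho> \<le> 1" and y: "(\<Sum>i<m. pstar $ i * y i) = 0"
  shows "(1 - \<rho>) * (\<Sum>i<m. pstar $ i * (y i)\<^sup>2)
    \<le> (\<Sum>j<n. (\<Sum>i<m. pstar $ i * V i j * y i)\<^sup>2 / den pstar j)"
proof -
  let ?N = "\<Sum>i<m. pstar $ i * (y i)\<^sup>2"
  \<comment> \<open>\<open>z\<close> carries the measure \<open>p\<^sup>* y\<close> over to the weights of the original algorithm;
    since it has total mass \<open>0\<close>, the rank-one corrections in \<open>V = s W - 1 g\<close> drop out.\<close>
  define z where "z i = pstar $ i * y i / phat $ i" for i
  have phat_z: "phat $ i * z i = pstar $ i * y i" if "i < m" for i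
    using phat_pos[OF that] by (simp add: z_def)
  define T where "T j = (\<Sum>i<m. phat $ i * W $$ (i, j) * z i)" for j
  have "(\<Sum>i<m. pstar $ i * V i j * y i) = s * T j" if j: "j < n" for j
  proof -
    let ?C = "s * (\<Sum>l<m. r $ l * W $$ (l, j)) + f $ j"
    have "(\<Sum>i<m. pstar $ i * V i j * y i)
        = (\<Sum>i<m. s * (W $$ (i, j) * (pstar $ i * y i)) - ?C * (pstar $ i * y i))"
      using j by (intro sum.cong refl) (simp add: V_eq algebra_simps)
    also have "\<dots> = s * (\<Sum>i<m. W $$ (i, j) * (pstar $ i * y i)) - ?C * (\<Sum>i<m. pstar $ i * y i)"
      by (simp only: sum_subtractf sum_distrib_left)
    also have "(\<Sum>i<m. W $$ (i, j) * (pstar $ i * y i)) = T j"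
      unfolding T_def by (intro sum.cong refl) (simp flip: phat_z)
    also have "s * T j - ?C * (\<Sum>i<m. pstar $ i * y i) = s * T j"
      by (simp add: y)
    finally show ?thesis .
  qed
  then have "(\<Sum>j<n. (\<Sum>i<m. pstar $ i * V i j * y i)\<^sup>2 / den pstar j)
      = s\<^sup>2 / (1 + entry_sum f) * (\<Sum>j<n. (T j)\<^sup>2 / qhat j)"
    by (simp add: den_pstar power_mult_distrib sum_distrib_left)
  moreover have "(1 - entry_sum r) * ?N \<le> (\<Sum>i<m. phat $ i * (z i)\<^sup>2)"
    unfolding sum_distrib_left
  proof (intro sum_mono)
    fix i assume "i \<in> {..<m}"
    then have i: "i < m" by simp
    \<comment> \<open>This is \<open>(1 - entry_sum r) * phat \<le> pstar\<close> times
      \<open>pstar y^2\<close>; dividing by \<open>phat\<close> produces \<open>phat z^2\<close> on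
      the right.\<close>
    have "(1 - entry_sum r) * phat $ i * (pstar $ i * (y i)\<^sup>2) \<le> pstar $ i * (pstar $ i * (y i)\<^sup>2)"
      using i r_nonneg[OF i] pstar_pos[OF i] by (intro mult_right_mono) (auto simp: pstar_index)
    then show "(1 - entry_sum r) * (pstar $ i * (y i)\<^sup>2) \<le> phat $ i * (z i)\<^sup>2"
      using phat_pos[OF i] by (simp add: z_def field_simps power2_eq_square)
  qed
  then have "(1 - \<rho>) * ((1 - entry_sum r) * ?N) \<le> (\<Sum>j<n. (T j)\<^sup>2 / qhat j)"
    using base[of z] rho unfolding T_def[symmetric]
    by (meson diff_ge_0_iff_ge mult_left_mono order_trans)
  then have "s\<^sup>2 / (1 + entry_sum f) * ((1 - \<rho>) * ((1 - entry_sum r) * ?N))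
      \<le> s\<^sup>2 / (1 + entry_sum f) * (\<Sum>j<n. (T j)\<^sup>2 / qhat j)"
    using f_plus_nonneg by (intro mult_left_mono) auto
  moreover have "s\<^sup>2 / (1 + entry_sum f) * ((1 - \<rho>) * ((1 - entry_sum r) * ?N)) = s * ((1 - \<rho>) * ?N)"
    using f_plus_nonneg r_less_1 by (simp add: s_def power2_eq_square)
  moreover have "1 * ((1 - \<rho>) * ?N) \<le> s * ((1 - \<rho>) * ?N)"
  proof (rule mult_right_mono[OF s_ge_1])
    have "0 \<le> ?N" using pstar_pos by (intro sum_nonneg) (simp add: less_imp_le)
    then show "0 \<le> (1 - \<rho>) * ?N" using rho by simp
  qed
  ultimately show ?thesis by simp
qed

lemma eigenvalue_le:
  assumes ev: "eigenvector (map_mat complex_of_real R) x \<mu>"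
    and base: "\<And>z. (1 - \<rho>) * (\<Sum>i<m. phat $ i * (z i)\<^sup>2)
      \<le> (\<Sum>j<n. (\<Sum>i<m. phat $ i * W $$ (i, j) * z i)\<^sup>2 / qhat j)"
    and rho: "\<rho> \<ge> 0"
  shows "cmod \<mu> \<le> \<rho>"
proof -
  \<comment> \<open>\<open>R\<close> kills constants, so \<open>x\<close> may be replaced by its projection \<open>y\<close> orthogonal to constants,
    on which pairing with \<open>y\<close> shows that \<open>\<mu>\<close> is real.\<close>
  let ?c = complex_of_real
  have x: "x \<in> carrier_vec m" "x \<noteq> 0\<^sub>v m" and eq: "map_mat ?c R *\<^sub>v x = \<mu> \<cdot>\<^sub>v x"
    using ev R_carrier by (auto simp: eigenvector_def)
  define c where "c = (\<Sum>i<m. ?c (pstar $ i) * x $ i)"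
  define y where "y i = x $ i - c" for i
  define b where "b j = (\<Sum>i<m. ?c (pstar $ i * V i j) * y i)" for j
  have y_mean: "(\<Sum>i<m. ?c (pstar $ i) * y i) = 0"
  proof -
    have "(\<Sum>i<m. ?c (pstar $ i) * y i) = c - ?c (\<Sum>i<m. pstar $ i) * c"
      by (simp add: y_def c_def[symmetric] right_diff_distrib sum_subtractf sum_distrib_right)
    then show ?thesis by (simp add: pstar_sum)
  qed
  \<comment> \<open>The kernel of \<open>R\<close> contains \<open>V + f\<close>. Against
    \<open>y\<close> the part \<open>f\<close> sees only the mean, which is 0; against the constant
    \<open>c\<close> the sum is the full denominator.\<close>
  have inner: "(\<Sum>i<m. ?c (pstar $ i * (V i j + f $ j)) * x $ i) = b j + c * ?c (den pstar j)" for j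
  proof -
    have "(\<Sum>i<m. ?c (pstar $ i * (V i j + f $ j)) * x $ i)
        = (\<Sum>i<m. ?c (pstar $ i * V i j) * y i + ?c (f $ j) * (?c (pstar $ i) * y i)
            + c * (?c (pstar $ i * V i j) + ?c (f $ j) * ?c (pstar $ i)))"
      by (intro sum.cong refl) (simp add: y_def algebra_simps)
    also have "\<dots> = b j + ?c (f $ j) * (\<Sum>i<m. ?c (pstar $ i) * y i)
        + c * ((\<Sum>i<m. ?c (pstar $ i * V i j)) + ?c (f $ j) * (\<Sum>i<m. ?c (pstar $ i)))"
      by (simp only: b_def sum.distrib sum_distrib_left[symmetric])
    also have "(\<Sum>i<m. ?c (pstar $ i)) = 1"
      using pstar_sum by (metis of_real_1 of_real_sum)
    finally show ?thesis by (simp add: y_mean add.commute)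
  qed
  have Rx: "\<mu> * x $ k = y k - (\<Sum>j<n. ?c (V k j / den pstar j) * b j)" if k: "k < m" for k
  proof -
    have "\<mu> * x $ k = (\<Sum>i<m. ?c (R $$ (k, i)) * x $ i)"
      using arg_cong[OF eq, of "\<lambda>v. v $ k"] x k R_carrier
      by (simp add: scalar_prod_def atLeast0LessThan)
    also have "\<dots> = (\<Sum>i<m. (if i = k then x $ i else 0)
        - (\<Sum>j<n. ?c (V k j / den pstar j) * (?c (pstar $ i * (V i j + f $ j)) * x $ i)))"
    proof (intro sum.cong refl)
      fix i assume "i \<in> {..<m}"
      then have "R $$ (k, i) = (if i = k then 1 else 0)
          - (\<Sum>j<n. V k j / den pstar j * (pstar $ i * (V i j + f $ j)))"
        using k by (simp add: R_index sum_distrib_left mult_ac)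
      moreover have "?c ((if i = k then 1 else 0) - (\<Sum>j<n. E j * D j)) * x $ i
          = (if i = k then x $ i else 0) - (\<Sum>j<n. ?c (E j) * (?c (D j) * x $ i))" for E D
        by (simp add: left_diff_distrib sum_distrib_right mult.assoc)
      ultimately show "?c (R $$ (k, i)) * x $ i = (if i = k then x $ i else 0)
          - (\<Sum>j<n. ?c (V k j / den pstar j) * (?c (pstar $ i * (V i j + f $ j)) * x $ i))"
        by (simp only:)
    qed
    also have "\<dots> = x $ k
        - (\<Sum>i<m. \<Sum>j<n. ?c (V k j / den pstar j) * (?c (pstar $ i * (V i j + f $ j)) * x $ i))"
      using k by (simp add: sum_subtractf)
    also have "\<dots> = x $ k - (\<Sum>j<n. ?c (V k j / den pstar j) * (b j + c * ?c (den pstar j)))"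
      by (subst sum.swap) (simp only: sum_distrib_left[symmetric] inner)
    also have "\<dots> = x $ k - (\<Sum>j<n. ?c (V k j / den pstar j) * b j + c * ?c (V k j))"
    proof -
      have "?c (V k j / den pstar j) * (b j + c * ?c (den pstar j))
          = ?c (V k j / den pstar j) * b j + c * ?c (V k j)" if "j < n" for j
      proof -
        have "?c (V k j / den pstar j) * ?c (den pstar j) = ?c (V k j)"
          unfolding of_real_mult[symmetric] using den_pstar_pos[OF that] by simp
        then show ?thesis by (simp only: distrib_left mult.left_commute[of _ c])
      qed
      then show ?thesis by simp
    qed
    also have "\<dots> = y k - (\<Sum>j<n. ?c (V k j / den pstar j) * b j)"
    proof -
      \<comment> \<open>Cancelling the denominators left \<open>c\<close> times a row sum of
        \<open>V\<close>, so exactly \<open>c\<close> is subtracted from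
        \<open>x $ k\<close>.\<close>
      have "(\<Sum>j<n. ?c (V k j)) = 1"
        using V_row_sum[OF k] by (metis of_real_1 of_real_sum)
      then show ?thesis by (simp add: sum.distrib sum_distrib_left[symmetric] y_def)
    qed
    finally show ?thesis .
  qed
  define N where "N = (\<Sum>i<m. pstar $ i * (cmod (y i))\<^sup>2)"
  define G where "G = (\<Sum>j<n. (cmod (b j))\<^sup>2 / den pstar j)"
  have mu_N: "\<mu> * ?c N = ?c (N - G)"
  proof -
    have y_mean': "(\<Sum>k<m. ?c (pstar $ k) * cnj (y k)) = 0"
      using arg_cong[OF y_mean, of cnj] by simp
    \<comment> \<open>With \<open>x = y + c\<close>, the constant part drops out because
      \<open>cnj y\<close> also has weighted mean 0.\<close>
    have "(\<Sum>k<m. ?c (pstar $ k) * cnj (y k) * (\<mu> * x $ k))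
        = (\<Sum>k<m. \<mu> * ?c (pstar $ k * (cmod (y k))\<^sup>2) + \<mu> * c * (?c (pstar $ k) * cnj (y k)))"
      unfolding of_real_mult complex_norm_square
      by (intro sum.cong refl) (simp add: y_def algebra_simps)
    also have "\<dots> = \<mu> * ?c N"
      by (simp add: sum.distrib sum_distrib_left[symmetric] y_mean' N_def)
    finally have "\<mu> * ?c N = (\<Sum>k<m. ?c (pstar $ k) * cnj (y k) * (\<mu> * x $ k))" by simp
    also have "\<dots> = (\<Sum>k<m. ?c (pstar $ k * (cmod (y k))\<^sup>2)
        - (\<Sum>j<n. b j / ?c (den pstar j) * (?c (pstar $ k * V k j) * cnj (y k))))"
      unfolding of_real_mult of_real_divide complex_norm_square
      by (intro sum.cong refl)
        (simp add: Rx of_real_divide right_diff_distrib sum_distrib_left mult_ac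
          del: of_real_add of_real_sum)
    also have "\<dots> = ?c N - (\<Sum>j<n. b j / ?c (den pstar j) * (\<Sum>k<m. ?c (pstar $ k * V k j) * cnj (y k)))"
      unfolding sum_subtractf N_def of_real_sum
      by (subst sum.swap) (simp only: sum_distrib_left)
    also have "\<dots> = ?c N - (\<Sum>j<n. b j / ?c (den pstar j) * cnj (b j))"
      by (simp add: b_def)
    also have "\<dots> = ?c (N - G)"
      by (simp only: G_def of_real_diff of_real_sum of_real_divide complex_norm_square
          times_divide_eq_left)
    finally show ?thesis .
  qed
  show ?thesis
  proof (cases "\<forall>i<m. y i = 0")
    \<comment> \<open>Here \<open>x\<close> is constant, so its eigenvalue is 0.\<close>
    case True
    then have "b j = 0" for j by (simp add: b_def)
    then have "\<mu> * x $ k = 0" if "k < m" for k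
      using Rx[OF that] True that by simp
    moreover obtain k where "k < m" "x $ k \<noteq> 0"
      using x by (metis carrier_vecD eq_vecI index_zero_vec)
    ultimately have "\<mu> = 0" by (metis mult_eq_0_iff)
    then show ?thesis using rho by simp
  next
    case False
    then obtain k where k: "k < m" "y k \<noteq> 0" by blast
    have N: "N > 0" unfolding N_def
      using k pstar_pos by (intro sum_pos2[of _ k]) (auto simp: less_imp_le)
    \<comment> \<open>The weights and \<open>V\<close> are real, so both forms split into real and
      imaginary parts, to which the real estimates apply.\<close>
    have N_split: "N = (\<Sum>i<m. pstar $ i * (Re (y i))\<^sup>2) + (\<Sum>i<m. pstar $ i * (Im (y i))\<^sup>2)"
      by (simp add: N_def cmod_power2 distrib_left sum.distrib)
    have G_split: "G = (\<Sum>j<n. (\<Sum>i<m. pstar $ i * V i j * Re (y i))\<^sup>2 / den pstar j)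
        + (\<Sum>j<n. (\<Sum>i<m. pstar $ i * V i j * Im (y i))\<^sup>2 / den pstar j)"
      by (simp add: G_def b_def cmod_power2 add_divide_distrib sum.distrib)
    have "G \<le> N"
      unfolding N_split G_split by (intro add_mono form_le)
    moreover have "\<mu> = ?c ((N - G) / N)"
      using mu_N N by (simp add: field_simps)
    ultimately have mu: "cmod \<mu> = (N - G) / N"
      using N by (simp only: norm_of_real) simp
    have "G \<ge> 0" unfolding G_def
      using den_pstar_pos by (intro sum_nonneg divide_nonneg_pos) auto
    show ?thesis
    proof (cases "\<rho> \<le> 1")
      case True
      have "(1 - \<rho>) * N \<le> G"
        unfolding N_split G_split distrib_left
        using arg_cong[OF y_mean, of Re] arg_cong[OF y_mean, of Im]
        by (intro add_mono form_ge[OF base True]) simp_all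
      then have "N - G \<le> \<rho> * N" by (simp add: left_diff_distrib)
      then show ?thesis using N by (simp add: mu pos_divide_le_eq)
    next
      case False
      have "(N - G) / N \<le> 1" using N \<open>G \<ge> 0\<close> by simp
      then show ?thesis using False by (simp add: mu)
    qed
  qed
qed

section \<open>The original algorithm and the comparison\<close>

text \<open>For zero parameters \<open>R\<close> is the identity minus a symmetric kernel times
  \<open>phat\<close>, hence self-adjoint for the weights \<open>phat\<close>. Since
  \<open>f = 0\<close>, pairing \<open>R z\<close> with \<open>z\<close> gives the squared norm
  minus the form for every \<open>z\<close>, with no orthogonality condition.\<close>

lemma original_form_ge:
  fixes z :: "nat \<Rightarrow> real"
  assumes r0: "r = 0\<^sub>v m" and f0: "f = 0\<^sub>v n"
  shows "(1 - spectral_radius (map_mat complex_of_real R)) * (\<Sum>i<m. phat $ i * (z i)\<^sup>2)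
      \<le> (\<Sum>j<n. (\<Sum>i<m. phat $ i * W $$ (i, j) * z i)\<^sup>2 / qhat j)"
proof -
  have zero: "entry_sum r = 0" "entry_sum f = 0"
    by (simp_all add: entry_sum_def r0 f0)
  have r: "r $ i = 0" if "i < m" for i using that by (simp add: r0)
  have f: "f $ j = 0" if "j < n" for j using that by (simp add: f0)
  have Rkl: "R $$ (k, l) = (if l = k then 1 else 0)
      - phat $ l * (\<Sum>j<n. W $$ (k, j) * W $$ (l, j) / qhat j)" if "k < m" "l < m" for k l
  proof -
    have V: "V i j = W $$ (i, j)" if "i < m" "j < n" for i j
      using that by (simp add: V_eq s_def zero r f)
    show ?thesis
      using that by (simp add: R_index V qhat_def pstar_index zero r f)
  qed
  define v where "v = vec m z"
  have Rv: "phat $ k * v $ k * (R *\<^sub>v v) $ k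
      = phat $ k * (z k)\<^sup>2 - (\<Sum>j<n. phat $ k * W $$ (k, j) * z k / qhat j * (\<Sum>l<m. phat $ l * W $$ (l, j) * z l))"
    if k: "k < m" for k
  proof -
    have "(R *\<^sub>v v) $ k = (\<Sum>l<m. R $$ (k, l) * z l)"
      using R_carrier k by (auto simp: v_def scalar_prod_def atLeast0LessThan intro!: sum.cong)
    also have "\<dots> = (\<Sum>l<m. (if l = k then z l else 0)
        - (\<Sum>j<n. W $$ (k, j) / qhat j * (phat $ l * W $$ (l, j) * z l)))"
      using k by (intro sum.cong refl)
        (auto simp: Rkl sum_distrib_left sum_distrib_right left_diff_distrib right_diff_distrib mult_ac)
    also have "\<dots> = z k - (\<Sum>l<m. \<Sum>j<n. W $$ (k, j) / qhat j * (phat $ l * W $$ (l, j) * z l))"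
      using k by (simp add: sum_subtractf)
    also have "\<dots> = z k - (\<Sum>j<n. W $$ (k, j) / qhat j * (\<Sum>l<m. phat $ l * W $$ (l, j) * z l))"
      by (subst sum.swap) (simp only: sum_distrib_left)
    finally have "(R *\<^sub>v v) $ k = \<dots>" .
    moreover have "phat $ k * z k * (z k - (\<Sum>j<n. W $$ (k, j) / qhat j * T j))
        = phat $ k * (z k)\<^sup>2 - (\<Sum>j<n. phat $ k * W $$ (k, j) * z k / qhat j * T j)" for T
      by (simp add: power2_eq_square right_diff_distrib sum_distrib_left mult_ac)
    ultimately show ?thesis
      using k by (simp only:) (simp add: v_def)
  qed
  have "(\<Sum>k<m. phat $ k * v $ k * (R *\<^sub>v v) $ k)
      = (\<Sum>k<m. phat $ k * (z k)\<^sup>2) - (\<Sum>j<n. (\<Sum>k<m. phat $ k * W $$ (k, j) * z k)\<^sup>2 / qhat j)"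
  proof -
    have "(\<Sum>k<m. phat $ k * v $ k * (R *\<^sub>v v) $ k)
        = (\<Sum>k<m. phat $ k * (z k)\<^sup>2 - (\<Sum>j<n. phat $ k * W $$ (k, j) * z k / qhat j
            * (\<Sum>l<m. phat $ l * W $$ (l, j) * z l)))"
      by (intro sum.cong refl Rv) simp
    also have "\<dots> = (\<Sum>k<m. phat $ k * (z k)\<^sup>2) - (\<Sum>j<n. (\<Sum>k<m. phat $ k * W $$ (k, j) * z k / qhat j)
            * (\<Sum>l<m. phat $ l * W $$ (l, j) * z l))"
      unfolding sum_subtractf
      by (subst sum.swap) (simp only: sum_distrib_right)
    finally show ?thesis
      by (simp only: sum_divide_distrib[symmetric] power2_eq_square times_divide_eq_left)
  qed
  moreover have "(\<Sum>k<m. phat $ k * v $ k * (R *\<^sub>v v) $ k)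
      \<le> spectral_radius (map_mat complex_of_real R) * (\<Sum>k<m. phat $ k * (v $ k)\<^sup>2)"
  proof (rule selfadjoint_quadratic_form_le[OF R_carrier m_pos])
    show "phat $ i * R $$ (i, j) = phat $ j * R $$ (j, i)" if "i < m" "j < m" for i j
      using that by (auto simp: Rkl algebra_simps)
  qed (auto simp: v_def phat_pos)
  ultimately show ?thesis
    by (simp add: v_def left_diff_distrib cong: sum.cong_simp)
qed

lemma global_rate_eq: "global_rate W phat r f = spectral_radius (map_mat complex_of_real R)"
  by (simp add: global_rate_def R_def pstar_def)

text \<open>Because \<open>W\<close> has unit row sums, \<open>1 + entry_sum g\<close> equals
  \<open>s\<close>, so the inverse formula returns \<open>f\<close>.\<close>

lemma global_rate_tilde_eq:
  assumes g: "g = ((1 + entry_sum f) / (1 - entry_sum r)) \<cdot>\<^sub>v (transpose_mat W *\<^sub>v r) + f"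
  shows "global_rate_tilde W phat r g = global_rate W phat r f"
proof -
  have rW: "(transpose_mat W *\<^sub>v r) $ j = (\<Sum>l<m. r $ l * W $$ (l, j))" if "j < n" for j
    using that dims by (auto simp: scalar_prod_def atLeast0LessThan mult.commute intro!: sum.cong)
  have g_index: "g $ j = s * (\<Sum>l<m. r $ l * W $$ (l, j)) + f $ j" if "j < n" for j
    using that dims rW by (simp add: g s_def)
  have g_dim: "dim_vec g = n"
    using dims by (simp add: g)
  have "1 + entry_sum g = 1 + s * entry_sum r + entry_sum f"
    by (simp add: entry_sum_def[of g] g_dim g_index sum.distrib sum_distrib_left[symmetric] r_W_sum entry_sum_f)
  also have "\<dots> = s" using r_less_1 by (simp add: s_def field_simps)
  finally have "g - (1 + entry_sum g) \<cdot>\<^sub>v (transpose_mat W *\<^sub>v r) = f"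
    using dims g_dim by (intro eq_vecI) (auto simp: g_index rW simp del: index_mult_mat_vec)
  then show ?thesis by (simp add: global_rate_tilde_def)
qed

end

lemma admissible_zero:
  assumes W: "W \<in> carrier_mat m n" and st: "stochastic W"
  shows "admissible W (0\<^sub>v m) (0\<^sub>v n)"
proof -
  have zero: "entry_sum (0\<^sub>v k) = 0" for k by (simp add: entry_sum_def)
  have dims: "dim_row (W_tilde W (0\<^sub>v m) (0\<^sub>v n)) = m" "dim_col (W_tilde W (0\<^sub>v m) (0\<^sub>v n)) = n"
    using W by (auto simp: W_tilde_def Let_def)
  have "W_tilde W (0\<^sub>v m) (0\<^sub>v n) = W"
    using W dims by (intro eq_matI) (auto simp: W_tilde_index[OF W] zero)
  then show ?thesis
    using W st zero by (auto simp: admissible_def stochastic_def less_eq_vec_def)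
qed

theorem corollary4:
  fixes m n :: nat and W :: "real mat" and phat r f g :: "real vec"
  assumes "W \<in> carrier_mat m n"
    and "stochastic W"
    and "\<exists>i<m. \<exists>k<m. row W i \<noteq> row W k"
    and "\<forall>j<n. col W j \<noteq> 0\<^sub>v m"
    and "\<forall>i<m. phat $ i > 0"
    and "final_output W (0\<^sub>v m) (0\<^sub>v n) phat"
    and "admissible W r f"
    and "final_output W r f phat"
    and "g = ((1 + entry_sum f) / (1 - entry_sum r)) \<cdot>\<^sub>v (transpose_mat W *\<^sub>v r) + f"
  shows "global_rate W phat r f = global_rate_tilde W phat r g
    \<and> global_rate_tilde W phat r g \<le> global_rate_tilde W phat (0\<^sub>v m) (0\<^sub>v n)
    \<and> global_rate_tilde W phat (0\<^sub>v m) (0\<^sub>v n) = global_rate W phat (0\<^sub>v m) (0\<^sub>v n)"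
proof -
  have m: "m > 0" using assms(3) by auto
  interpret AB: arimoto_blahut m n W phat r f
    using assms m by unfold_locales auto
  interpret AB0: arimoto_blahut m n W phat "0\<^sub>v m" "0\<^sub>v n"
    using assms m admissible_zero[OF assms(1,2)] by unfold_locales auto
  let ?\<rho> = "spectral_radius (map_mat complex_of_real AB0.R)"
  have "spectral_radius (map_mat complex_of_real AB.R) \<le> ?\<rho>"
  proof (rule spectral_radius_leI[of _ m])
    show "cmod \<mu> \<le> ?\<rho>" if "eigenvector (map_mat complex_of_real AB.R) x \<mu>" for \<mu> x
    \<comment> \<open>\<open>qhat\<close> involves only \<open>phat\<close> and \<open>W\<close>, so
      the estimate for the original algorithm is literally the premise required for
      \<open>(r, f)\<close>.\<close>
    proof (rule AB.eigenvalue_le[OF that AB0.original_form_ge[OF refl refl]])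
      show "0 \<le> ?\<rho>" using AB0.R_carrier m by (intro spectral_radius_nonneg) auto
    qed
  qed (use AB.R_carrier m in auto)
  moreover have "global_rate_tilde W phat (0\<^sub>v m) (0\<^sub>v n) = global_rate W phat (0\<^sub>v m) (0\<^sub>v n)"
    using assms(1) by (intro AB0.global_rate_tilde_eq eq_vecI) auto
  ultimately show ?thesis
    using AB.global_rate_tilde_eq[OF assms(9)] AB.global_rate_eq AB0.global_rate_eq by simp
qed

end
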